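(* For all positive integers $n$ and $k$, we have in $\mathcal A$ $$T_{\mathcal A}(n,\{1\}^k)=T_{\mathcal A}(k+1,\{1\}^{n-1}).$$ In particular, for all positive integers $n$ and $k$, $$T_{\mathcal A}(2n,\{1\}^k)=(-1)^kT_{\mathcal A}(\{1\}^{2n-1},k+1),$$ $$T_{\mathcal A}(2n+1,\{1\}^k)=(-1)^{k+1}S_{\mathcal A}(\{1\}^{2n},k+1).$$
   Context: Let $\mathcal P$ be the set of primes and $\mathcal A=\prod_{p\in\mathcal P}(\mathbb Z/p\mathbb Z)\big/\bigoplus_{p\in\mathcal P}(\mathbb Z/p\mathbb Z)$; two elements are equal iff their components agree for all but finitely many $p$. $\{1\}^m$ denotes the string $1,\dots,1$ of length $m$ (empty if $m=0$). For positive integers $s_1,\dots,s_d$, $T_{\mathcal A}(s_1,\dots,s_d)$ and $S_{\mathcal A}(s_1,\dots,s_d)$ are the classes in $\mathcal A$ of the tuples whose $p$-components are $\sum\frac{2^d}{n_1^{s_1}\cdots n_d^{s_d}}\bmod p$, summed over $p>n_1>\dots>n_d>0$ with $n_j\equiv d-j+1\pmod 2$ for all $j$ (for $T$), respectively $n_j\equiv d-j\pmod 2$ for all $j$ (for $S$). *)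

theory Defs
  imports "HOL-Number_Theory.Number_Theory" "HOL-Algebra.QuotRing"
begin

section \<open>The ring \<open>\<A>\<close>\<close>

text \<open>
  Elements of the product over all primes \<open>p\<close> of \<open>\<int>/p\<int>\<close> are extensional functions on the set of
  primes; their \<open>p\<close>-component lies in \<^const>\<open>residue_ring\<close> \<open>p\<close>, i.e. in \<open>{0..p-1}\<close>.
\<close>

definition prime_residues_prod :: "(nat \<Rightarrow> int) ring" where
  "prime_residues_prod =
     \<lparr>carrier = (\<Pi>\<^sub>E p\<in>{p. prime p}. carrier (residue_ring (int p))),
      monoid.mult = (\<lambda>x y. \<lambda>p\<in>{p. prime p}. x p \<otimes>\<^bsub>residue_ring (int p)\<^esub> y p),
      one = (\<lambda>p\<in>{p. prime p}. \<one>\<^bsub>residue_ring (int p)\<^esub>),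
      zero = (\<lambda>p\<in>{p. prime p}. \<zero>\<^bsub>residue_ring (int p)\<^esub>),
      add = (\<lambda>x y. \<lambda>p\<in>{p. prime p}. x p \<oplus>\<^bsub>residue_ring (int p)\<^esub> y p)\<rparr>"

definition prime_residues_sum :: "(nat \<Rightarrow> int) set" where
  "prime_residues_sum =
     {x \<in> carrier prime_residues_prod.
        finite {p. prime p \<and> x p \<noteq> \<zero>\<^bsub>residue_ring (int p)\<^esub>}}"

definition A_ring :: "(nat \<Rightarrow> int) set ring" where
  "A_ring = prime_residues_prod Quot prime_residues_sum"

definition A_class :: "(nat \<Rightarrow> int) \<Rightarrow> (nat \<Rightarrow> int) set" where
  "A_class f =
     prime_residues_sum +>\<^bsub>prime_residues_prod\<^esub> (\<lambda>p\<in>{p. prime p}. f p mod int p)"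

lemma residue_ring_prime_cring: "prime p \<Longrightarrow> cring (residue_ring (int p))"
  using residues.cring[of "int p"] prime_gt_1_nat[of p] by (simp add: residues_def)

lemma mod_in_prime_residues_prod:
  "(\<lambda>p\<in>{p. prime p}. f p mod int p) \<in> carrier prime_residues_prod"
proof -
  have "f p mod int p \<in> {0..int p - 1}" if "prime p" for p
    using pos_mod_bound[of "int p" "f p"] prime_gt_0_nat[OF that] by simp
  then show ?thesis
    by (simp add: prime_residues_prod_def residue_ring_def)
qed

lemma prime_residues_prod_cring: "cring prime_residues_prod"
proof -
  let ?R = "\<lambda>p::nat. residue_ring (int p)"
  note R = residue_ring_prime_cring
  have ring: "ring (?R p)" if "prime p" for p
    using R[OF that] by (rule cring.axioms)
  note defs = prime_residues_prod_def fun_eq_iff PiE_iff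
  note closed = ring.ring_simprules(1,2,5,6)[OF ring]
  show ?thesis
  proof (intro cringI abelian_groupI comm_monoidI)
    fix x assume x: "x \<in> carrier prime_residues_prod"
    let ?y = "\<lambda>p\<in>{p. prime p}. \<ominus>\<^bsub>?R p\<^esub> x p"
    have "?y \<in> carrier prime_residues_prod"
      using x by (simp add: defs ring.ring_simprules(3)[OF ring])
    moreover have "?y \<oplus>\<^bsub>prime_residues_prod\<^esub> x = \<zero>\<^bsub>prime_residues_prod\<^esub>"
      using x by (simp add: defs ring.ring_simprules(9)[OF ring])
    ultimately show "\<exists>y\<in>carrier prime_residues_prod.
        y \<oplus>\<^bsub>prime_residues_prod\<^esub> x = \<zero>\<^bsub>prime_residues_prod\<^esub>" by blast
  qed (simp_all add: defs closed ring.ring_simprules(7,8,11,12,13)[OF ring]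
        ring.ring_simprules(10,15,22,23)[OF ring] cring.cring_simprules(14,24)[OF R]
        monoid.r_one[OF ring.is_monoid[OF ring]] extensional_def)
qed

lemma prime_residues_minus:
  assumes "x \<in> carrier prime_residues_prod" "prime p"
  shows "(\<ominus>\<^bsub>prime_residues_prod\<^esub> x) p = \<ominus>\<^bsub>residue_ring (int p)\<^esub> x p"
proof -
  interpret P: cring prime_residues_prod by (rule prime_residues_prod_cring)
  interpret R: cring "residue_ring (int p)" by (rule residue_ring_prime_cring) fact
  have m: "\<ominus>\<^bsub>prime_residues_prod\<^esub> x \<in> carrier prime_residues_prod"
    using assms by simp
  have "\<ominus>\<^bsub>prime_residues_prod\<^esub> x \<oplus>\<^bsub>prime_residues_prod\<^esub> x = \<zero>\<^bsub>prime_residues_prod\<^esub>"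
    using assms by (simp add: P.l_neg)
  from fun_cong[OF this, of p]
  have "(\<ominus>\<^bsub>prime_residues_prod\<^esub> x) p \<oplus>\<^bsub>residue_ring (int p)\<^esub> x p = \<zero>\<^bsub>residue_ring (int p)\<^esub>"
    using \<open>prime p\<close> by (simp add: prime_residues_prod_def)
  moreover have "x p \<in> carrier (residue_ring (int p))"
      "(\<ominus>\<^bsub>prime_residues_prod\<^esub> x) p \<in> carrier (residue_ring (int p))"
    using assms m by (auto simp: prime_residues_prod_def PiE_iff)
  ultimately show ?thesis
    using R.minus_equality by metis
qed

lemma prime_residues_sum_ideal: "ideal prime_residues_sum prime_residues_prod"
proof -
  interpret P: cring prime_residues_prod by (rule prime_residues_prod_cring)
  note R = residue_ring_prime_cring
  have ring: "ring (residue_ring (int p))" if "prime p" for p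
    using R[OF that] by (rule cring.axioms)
  note laws = ring.ring_simprules(2,8,21,25)[OF ring]
  have comp: "x p \<in> carrier (residue_ring (int p))"
    if "x \<in> carrier prime_residues_prod" "prime p" for x p
    using that by (auto simp: prime_residues_prod_def PiE_iff)
  let ?N = "\<lambda>x. {p. prime p \<and> x p \<noteq> \<zero>\<^bsub>residue_ring (int p)\<^esub>}"
  have "subgroup prime_residues_sum (add_monoid prime_residues_prod)"
  proof (rule subgroup.intro)
    have empty: "?N \<zero>\<^bsub>prime_residues_prod\<^esub> = {}"
      by (auto simp: prime_residues_prod_def)
    show "\<one>\<^bsub>add_monoid prime_residues_prod\<^esub> \<in> prime_residues_sum"
      unfolding prime_residues_sum_def mem_Collect_eq monoid.simps empty by simp
  next
    fix x y assume xy: "x \<in> prime_residues_sum" "y \<in> prime_residues_sum"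
    have "?N (x \<oplus>\<^bsub>prime_residues_prod\<^esub> y) \<subseteq> ?N x \<union> ?N y"
      using laws by (auto simp: prime_residues_prod_def)
    then have "x \<oplus>\<^bsub>prime_residues_prod\<^esub> y \<in> prime_residues_sum"
      using xy by (auto simp: prime_residues_sum_def intro: finite_subset)
    then show "x \<otimes>\<^bsub>add_monoid prime_residues_prod\<^esub> y \<in> prime_residues_sum"
      by simp
  next
    fix x assume x: "x \<in> prime_residues_sum"
    then have xc: "x \<in> carrier prime_residues_prod"
      by (simp add: prime_residues_sum_def)
    have "?N (\<ominus>\<^bsub>prime_residues_prod\<^esub> x) \<subseteq> ?N x"
      using laws by (auto simp: prime_residues_minus xc)
    then have "\<ominus>\<^bsub>prime_residues_prod\<^esub> x \<in> prime_residues_sum"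
      using x xc by (auto simp: prime_residues_sum_def intro: finite_subset)
    then show "inv\<^bsub>add_monoid prime_residues_prod\<^esub> x \<in> prime_residues_sum"
      unfolding a_inv_def .
  next
    show "prime_residues_sum \<subseteq> carrier (add_monoid prime_residues_prod)"
      by (auto simp: prime_residues_sum_def)
  qed
  then show ?thesis
  proof (rule idealI[OF cring.axioms(1)[OF prime_residues_prod_cring]])
    fix a x assume a: "a \<in> prime_residues_sum" and x: "x \<in> carrier prime_residues_prod"
    have "?N (x \<otimes>\<^bsub>prime_residues_prod\<^esub> a) \<subseteq> ?N a"
      using laws comp[OF x] by (auto simp: prime_residues_prod_def)
    then show "x \<otimes>\<^bsub>prime_residues_prod\<^esub> a \<in> prime_residues_sum"
      using a x by (auto simp: prime_residues_sum_def intro: finite_subset)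
    then show "a \<otimes>\<^bsub>prime_residues_prod\<^esub> x \<in> prime_residues_sum"
      using a x by (simp add: P.m_comm prime_residues_sum_def)
  qed
qed

lemma A_ring_cring: "cring A_ring"
  unfolding A_ring_def
  by (rule ideal.quotient_is_cring[OF prime_residues_sum_ideal prime_residues_prod_cring])

lemma A_class_in_carrier: "A_class f \<in> carrier A_ring"
proof -
  interpret ideal prime_residues_sum prime_residues_prod by (rule prime_residues_sum_ideal)
  show ?thesis
    unfolding A_class_def A_ring_def FactRing_def
    by (simp add: a_rcosetsI[OF a_subset] mod_in_prime_residues_prod)
qed

lemma A_class_eq_iff:
  "A_class f = A_class g \<longleftrightarrow> finite {p. prime p \<and> \<not> [f p = g p] (mod int p)}"
proof -
  interpret ideal prime_residues_sum prime_residues_prod by (rule prime_residues_sum_ideal)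
  interpret P: cring prime_residues_prod by (rule prime_residues_prod_cring)
  define F where "F = (\<lambda>p\<in>{p. prime p}. f p mod int p)"
  define G where "G = (\<lambda>p\<in>{p. prime p}. g p mod int p)"
  have F: "F \<in> carrier prime_residues_prod" and G: "G \<in> carrier prime_residues_prod"
    unfolding F_def G_def by (rule mod_in_prime_residues_prod)+
  let ?d = "F \<ominus>\<^bsub>prime_residues_prod\<^esub> G"
  have "A_class f = A_class g \<longleftrightarrow> ?d \<in> prime_residues_sum"
    unfolding A_class_def F_def[symmetric] G_def[symmetric]
    using quotient_eq_iff_same_a_r_cos[OF prime_residues_sum_ideal F G] by simp
  also have "\<dots> \<longleftrightarrow> finite {p. prime p \<and> ?d p \<noteq> \<zero>\<^bsub>residue_ring (int p)\<^esub>}"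
    unfolding prime_residues_sum_def mem_Collect_eq using ring.ring_simprules(4)[OF cring.axioms(1)[OF prime_residues_prod_cring] F G] by blast
  also have "{p. prime p \<and> ?d p \<noteq> \<zero>\<^bsub>residue_ring (int p)\<^esub>} =
      {p. prime p \<and> \<not> [f p = g p] (mod int p)}"
  proof (intro Collect_cong conj_cong refl)
    fix p :: nat assume p: "prime p"
    interpret R: cring "residue_ring (int p)" by (rule residue_ring_prime_cring) fact
    have c: "F p \<in> carrier (residue_ring (int p))" "G p \<in> carrier (residue_ring (int p))"
      using F G p by (auto simp: prime_residues_prod_def PiE_iff)
    have "?d p = F p \<ominus>\<^bsub>residue_ring (int p)\<^esub> G p"
      unfolding a_minus_def using p prime_residues_minus[OF G p]
      by (simp add: prime_residues_prod_def)
    moreover have "F p \<ominus>\<^bsub>residue_ring (int p)\<^esub> G p = \<zero>\<^bsub>residue_ring (int p)\<^esub> \<longleftrightarrow> F p = G p"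
      using c R.r_right_minus_eq by metis
    ultimately show "(?d p \<noteq> \<zero>\<^bsub>residue_ring (int p)\<^esub>) = (\<not> [f p = g p] (mod int p))"
      using p by (simp add: F_def G_def cong_def)
  qed
  finally show ?thesis .
qed


section \<open>Finite multiple \<open>T\<close>- and \<open>S\<close>-values\<close>

text \<open>
  Summation tuples \<open>p > n\<^sub>1 > \<dots> > n\<^sub>d > 0\<close> are lists of length \<open>d\<close>. List positions are \<open>0\<close>-based, so
  \<open>n\<^sub>j\<close> is \<open>ns ! (j - 1)\<close>: the parity condition \<open>n\<^sub>j \<equiv> d - j + 1\<close> reads
  \<open>ns ! i \<equiv> d - i\<close>, and \<open>n\<^sub>j \<equiv> d - j\<close> reads \<open>ns ! i \<equiv> d - Suc i\<close>.
\<close>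

definition dec_tuples :: "nat \<Rightarrow> nat \<Rightarrow> nat list set" where
  "dec_tuples p d =
     {ns. length ns = d \<and> sorted_wrt (>) ns \<and> (\<forall>n\<in>set ns. 0 < n \<and> n < p)}"

definition T_tuples :: "nat \<Rightarrow> nat \<Rightarrow> nat list set" where
  "T_tuples p d = {ns \<in> dec_tuples p d. \<forall>i<d. [ns ! i = d - i] (mod 2)}"

definition S_tuples :: "nat \<Rightarrow> nat \<Rightarrow> nat list set" where
  "S_tuples p d = {ns \<in> dec_tuples p d. \<forall>i<d. [ns ! i = d - Suc i] (mod 2)}"

text \<open>
  The term \<open>2^d / (n\<^sub>1^s\<^sub>1 \<cdots> n\<^sub>d^s\<^sub>d)\<close> of a sum modulo \<open>p\<close>, as an integer representing its residue.
  For \<open>ns \<in> dec_tuples p d\<close> with \<open>p\<close> prime, the denominator is coprime to \<open>p\<close>.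
\<close>

definition mod_term :: "nat \<Rightarrow> nat list \<Rightarrow> nat list \<Rightarrow> int" where
  "mod_term p s ns =
     2 ^ length s * modular_inverse (int p) (\<Prod>i<length s. int (ns ! i) ^ (s ! i))"

definition T_A :: "nat list \<Rightarrow> (nat \<Rightarrow> int) set" where
  "T_A s = A_class (\<lambda>p. \<Sum>ns\<in>T_tuples p (length s). mod_term p s ns)"

definition S_A :: "nat list \<Rightarrow> (nat \<Rightarrow> int) set" where
  "S_A s = A_class (\<lambda>p. \<Sum>ns\<in>S_tuples p (length s). mod_term p s ns)"

lemma finite_dec_tuples: "finite (dec_tuples p d)"
  by (rule finite_subset[OF _ finite_lists_length_eq[of "{..<p}" d]])
     (auto simp: dec_tuples_def)

lemma coprime_denominator:
  assumes "prime p" "ns \<in> dec_tuples p (length s)"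
  shows "coprime (\<Prod>i<length s. int (ns ! i) ^ (s ! i)) (int p)"
proof (rule prod_coprime_left)
  fix i assume "i \<in> {..<length s}"
  then have "ns ! i \<in> set ns"
    using assms(2) by (auto simp: dec_tuples_def)
  then have "0 < ns ! i" "ns ! i < p"
    using assms(2) by (auto simp: dec_tuples_def)
  then have "coprime (ns ! i) p"
    using \<open>prime p\<close> by (metis coprime_commute nat_dvd_not_less prime_imp_coprime)
  then show "coprime (int (ns ! i) ^ (s ! i)) (int p)"
    by simp
qed

end

theory Submission
  imports Defs
begin

text \<open>
  The heart of the matter is a duality modulo a prime \<open>p\<close>, valid once \<open>p\<close> is large compared with
  \<open>n\<close> and \<open>k\<close>. Modulo \<open>p\<close>, let \<open>c d m\<close> be the sum of \<open>2^d / (n\<^sub>1 \<cdots> n\<^sub>d)\<close> over the alternating-parity tuples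
  \<open>m = n\<^sub>1 > \<dots> > n\<^sub>d > 0\<close>, with \<open>n\<^sub>d\<close> odd. Then \<open>T(n, {1}^k)\<close> is the sum over \<open>0 < m < p\<close> of
  \<open>c (k + 1) m / m^(n - 1)\<close>.
  
  The key is the generating function in the depth. Since \<open>log ((1 + t) / (1 - t))\<close> has
  derivative \<open>2 / (1 - t^2)\<close>, iterated integration shows that \<open>\<Sum>d. c d m a^d\<close> is the coefficient of
  \<open>t^m\<close> in \<open>((1 + t) / (1 - t))^a\<close>, the Mittag-Leffler polynomial \<open>g\<^sub>m(a)\<close>. For natural numbers,
  \<open>m g\<^sub>m(a) = \<Sum>j. j 2^j (m choose j) (a choose j)\<close>, which is symmetric in \<open>m\<close> and \<open>a\<close>.
  
  As \<open>g\<^sub>m\<close> has degree \<open>m < p\<close>, its coefficients can be read off modulo \<open>p\<close> from its values: power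
  sums over the nonzero residues give \<open>c e m \<equiv> - (\<Sum>a. a^(-e) g\<^sub>m(a))\<close> for \<open>0 < e < p - 1\<close>. Hence
  \<open>T(n, {1}^(e - 1)) \<equiv> - (\<Sum>m. \<Sum>a. m^(-n) a^(-e) (m g\<^sub>m(a)))\<close>, and the symmetry of \<open>m g\<^sub>m(a)\<close>
  exchanges \<open>n\<close> and \<open>e\<close>. This is \<open>T_sum_duality\<close>, resting on
  \<open>times_mittag_leffler_commute\<close>, \<open>head_sum_generating_function\<close> and \<open>head_sum_eq_power_sum\<close>.
  
  The other two identities follow from the duality by the reflection \<open>n\<^sub>j \<mapsto> p - n\<^sub>d\<^sub>+\<^sub>1\<^sub>-\<^sub>j\<close>, which
  reverses the exponents and multiplies each term by \<open>(-1)^w\<close>, where \<open>w\<close> is the sum of the exponents. Because \<open>p\<close> is odd, it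
  preserves the parity pattern of \<open>T\<close> in even depth and turns it into that of \<open>S\<close> in odd depth
  (\<open>T_sum_reversal\<close>).
\<close>

section \<open>Values of the Mittag-Leffler polynomials\<close>

text \<open>
  Pascal's rule: the binomial transform of \<open>u\<close>, as a sequence in \<open>m\<close>, has the binomial transform of
  the shifted sequence as its difference sequence.
\<close>

lemma binomial_sum_Suc:
  fixes u :: "nat \<Rightarrow> nat"
  shows "(\<Sum>j\<le>Suc m. (Suc m choose j) * u j) =
         (\<Sum>j\<le>m. (m choose j) * u j) + (\<Sum>j\<le>m. (m choose j) * u (Suc j))"
proof -
  have "(\<Sum>j\<le>Suc m. (Suc m choose j) * u j) =
        u 0 + (\<Sum>j\<le>m. (m choose Suc j) * u (Suc j)) + (\<Sum>j\<le>m. (m choose j) * u (Suc j))"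
    by (simp only: sum.atMost_Suc_shift) (simp add: sum.distrib algebra_simps)
  also have "u 0 + (\<Sum>j\<le>m. (m choose Suc j) * u (Suc j)) = (\<Sum>j\<le>Suc m. (m choose j) * u j)"
    by (simp only: sum.atMost_Suc_shift) simp
  finally show ?thesis by simp
qed

text \<open>
  The coefficient of \<open>t^m\<close> in \<open>((1 + t) / (1 - t))^a = (1 + 2 t / (1 - t))^a\<close>: expanding the power
  gives \<open>\<Sum>i. 2^i (a choose i) (t / (1 - t))^i\<close>, and for \<open>m > 0\<close> the coefficient of \<open>t^m\<close> in
  \<open>(t / (1 - t))^i\<close> is \<open>m - 1 choose i - 1\<close>.
\<close>

primrec mittag_leffler :: "nat \<Rightarrow> nat \<Rightarrow> nat" where
  "mittag_leffler 0 a = 1"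
| "mittag_leffler (Suc m) a = (\<Sum>j\<le>m. (m choose j) * (2 ^ Suc j * (a choose Suc j)))"

text \<open>
  Absorbing the factor \<open>m\<close> into the binomial coefficient makes the summand symmetric in \<open>m\<close> and \<open>a\<close>.
\<close>

lemma times_mittag_leffler:
  "m * mittag_leffler m a = (\<Sum>j\<le>m. (m choose j) * (j * 2 ^ j * (a choose j)))"
proof (cases m)
  case (Suc l)
  have "Suc l * mittag_leffler (Suc l) a =
        (\<Sum>j\<le>l. (Suc l * (l choose j)) * (2 ^ Suc j * (a choose Suc j)))"
    by (simp add: sum_distrib_left algebra_simps)
  also have "\<dots> = (\<Sum>j\<le>l. (Suc l choose Suc j) * (Suc j * 2 ^ Suc j * (a choose Suc j)))"
    by (simp only: Suc_times_binomial [symmetric] mult_ac)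
  also have "\<dots> = (\<Sum>j\<le>Suc l. (Suc l choose j) * (j * 2 ^ j * (a choose j)))"
    by (simp add: sum.atMost_Suc_shift del: sum.atMost_Suc binomial_Suc_Suc)
  finally show ?thesis using Suc by simp
qed simp

lemma times_mittag_leffler_commute:
  "m * mittag_leffler m a = a * mittag_leffler a m"
proof -
  define t where "t m a j = (m choose j) * (j * 2 ^ j * (a choose j))" for m a j :: nat
  have extend: "m * mittag_leffler m a = (\<Sum>j\<le>m + a. t m a j)" for m a
    unfolding times_mittag_leffler t_def by (rule sum.mono_neutral_left) auto
  have "t m a j = t a m j" for j
    by (simp add: t_def)
  then show ?thesis
    unfolding extend[of m a] extend[of a m] by (simp add: add.commute)
qed

text \<open>
  The coefficientwise form of \<open>(1 - t^2) f' = 2 a f\<close> for \<open>f = ((1 + t) / (1 - t))^a\<close>. In terms of binomial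
  transforms, \<open>m g\<^sub>m(a)\<close> is the transform of \<open>u j = j 2^j (a choose j)\<close>; going from \<open>m\<close> to \<open>m + 2\<close>
  applies Pascal's rule twice, and the extra terms collapse by the absorption identity for \<open>a\<close>.
\<close>

lemma mittag_leffler_recurrence:
  "Suc (Suc m) * mittag_leffler (Suc (Suc m)) a =
     m * mittag_leffler m a + 2 * a * mittag_leffler (Suc m) a"
proof -
  define u where "u j = j * 2 ^ j * (a choose j)" for j
  have absorb: "2 * u (Suc j) + u (Suc (Suc j)) = 2 * a * (2 ^ Suc j * (a choose Suc j))" for j
  proof -
    have "Suc (Suc j) * (a choose Suc (Suc j)) + Suc j * (a choose Suc j) = a * (a choose Suc j)"
    proof (cases a)
      case (Suc b)
      have "Suc (Suc j) * (Suc b choose Suc (Suc j)) + Suc j * (Suc b choose Suc j) =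
            Suc b * ((b choose Suc j) + (b choose j))"
        by (simp only: Suc_times_binomial distrib_left)
      then show ?thesis using Suc by (simp only: binomial_Suc_Suc add.commute)
    qed simp
    then have "2 * 2 ^ Suc j * (Suc (Suc j) * (a choose Suc (Suc j)) + Suc j * (a choose Suc j)) =
               2 * 2 ^ Suc j * (a * (a choose Suc j))" by presburger
    then show ?thesis by (simp add: u_def algebra_simps)
  qed
  have "Suc (Suc m) * mittag_leffler (Suc (Suc m)) a =
        (\<Sum>j\<le>m. (m choose j) * u j) + (\<Sum>j\<le>m. (m choose j) * (2 * u (Suc j) + u (Suc (Suc j))))"
    unfolding times_mittag_leffler u_def[symmetric] binomial_sum_Suc
    by (simp add: sum.distrib distrib_left mult_2)
  also have "(\<Sum>j\<le>m. (m choose j) * u j) = m * mittag_leffler m a"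
    unfolding times_mittag_leffler u_def ..
  also have "(\<Sum>j\<le>m. (m choose j) * (2 * u (Suc j) + u (Suc (Suc j)))) =
             2 * a * mittag_leffler (Suc m) a"
    unfolding absorb by (simp add: sum_distrib_left mult_ac)
  finally show ?thesis .
qed

text \<open>
  The recurrence summed up, in the form that the nested sums over alternating-parity tuples satisfy.
\<close>

lemma times_mittag_leffler_eq_sum:
  "m * mittag_leffler m a = 2 * a * (\<Sum>l | l < m \<and> odd (l + m). mittag_leffler l a)"
proof (induction m rule: induct_nat_012)
  case (ge2 m)
  have "{l. l < Suc (Suc m) \<and> odd (l + Suc (Suc m))} = insert (Suc m) {l. l < m \<and> odd (l + m)}"
    by (auto simp: less_Suc_eq)
  then show ?case
    unfolding mittag_leffler_recurrence ge2(1) by (simp add: distrib_left)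
next
  case 1
  have "{l. l = 0 \<and> odd (Suc l)} = {0::nat}" by auto
  then show ?case by simp
qed simp

section \<open>Power sums modulo a prime\<close>

text \<open>
  If \<open>p - 1\<close> divides \<open>e\<close>, all summands are \<open>1\<close> by Fermat's theorem. Otherwise multiplication by
  a primitive root \<open>g\<close> permutes the nonzero residues, so the sum is unchanged when multiplied by
  \<open>g^e\<close>, which differs from \<open>1\<close>.
\<close>

lemma sum_power_mod_prime:
  fixes p e :: nat
  assumes "prime p"
  shows "[(\<Sum>a\<in>{0<..<p}. int a ^ e) = (if p - 1 dvd e then - 1 else 0)] (mod int p)"
proof (cases "p - 1 dvd e")
  case True
  have "[int a ^ e = 1] (mod int p)" if a: "a \<in> {0<..<p}" for a
  proof -
    have "[a ^ (p - 1) = 1] (mod p)"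
      using fermat_theorem[OF \<open>prime p\<close>] a by (auto dest: nat_dvd_not_less)
    then have "[a ^ e = 1] (mod p)"
      using True by (metis cong_pow dvdE power_mult power_one)
    then show ?thesis by (metis cong_int_iff of_nat_1 of_nat_power)
  qed
  then have "[(\<Sum>a\<in>{0<..<p}. int a ^ e) = (\<Sum>a\<in>{0<..<p}. 1)] (mod int p)"
    by (rule cong_sum)
  also have "(\<Sum>a\<in>{0<..<p}. 1) = int p - 1"
    using prime_gt_0_nat[OF assms] by (simp add: of_nat_diff)
  also have "[int p - 1 = - 1] (mod int p)"
    by (simp add: cong_iff_dvd_diff)
  finally show ?thesis using True by simp
next
  case False
  obtain g where g: "residue_primroot p g"
    using prime_primitive_root_exists[of p] assms prime_gt_1_nat by blast
  then have co: "coprime (int g) (int p)" and ord: "ord p g = p - 1"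
    using assms by (auto simp: residue_primroot_def totient_prime coprime_commute)
  have img: "{1..<int p} = int ` {0<..<p}"
    by (simp add: image_int_atLeastLessThan flip: atLeastSucLessThan_greaterThanLessThan)
  define s where "s = (\<Sum>x\<in>{1..<int p}. x ^ e)"
  have s: "s = (\<Sum>a\<in>{0<..<p}. int a ^ e)"
    unfolding s_def img by (simp add: sum.reindex)
  have "s = (\<Sum>x\<in>{1..<int p}. (int g * x mod int p) ^ e)"
    unfolding s_def using bij_betw_int_remainders_mult[OF co]
    by (rule sum.reindex_bij_betw[symmetric])
  also have "[\<dots> = (\<Sum>x\<in>{1..<int p}. (int g * x) ^ e)] (mod int p)"
    by (intro cong_sum cong_pow) simp
  also have "(\<Sum>x\<in>{1..<int p}. (int g * x) ^ e) = int g ^ e * s"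
    by (simp add: s_def power_mult_distrib sum_distrib_left)
  finally have "int p dvd (int g ^ e - 1) * s"
    by (simp add: cong_iff_dvd_diff algebra_simps dvd_diff_commute)
  moreover have "\<not> int p dvd int g ^ e - 1"
  proof
    assume "int p dvd int g ^ e - 1"
    then have "[g ^ e = 1] (mod p)"
      by (metis cong_iff_dvd_diff cong_int_iff of_nat_1 of_nat_power)
    then show False using False ord by (simp add: ord_divides')
  qed
  ultimately have "int p dvd s"
    using assms prime_dvd_multD by (metis prime_nat_int_transfer)
  then show ?thesis using False s by (simp add: cong_0_iff)
qed

section \<open>Inverses and summands modulo a prime\<close>

abbreviation minv :: "nat \<Rightarrow> nat \<Rightarrow> int" where
  "minv p m \<equiv> modular_inverse (int p) (int m)"

lemma coprime_prime_residue: "prime p \<Longrightarrow> 0 < m \<Longrightarrow> m < p \<Longrightarrow> coprime (int m) (int p)"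
  by (metis coprime_commute coprime_int_iff nat_dvd_not_less prime_imp_coprime)

lemma times_minv_cong: "prime p \<Longrightarrow> 0 < m \<Longrightarrow> m < p \<Longrightarrow> [int m * minv p m = 1] (mod int p)"
  by (intro cong_modular_inverse1 coprime_prime_residue)

lemma modular_inverse_cong_unique:
  fixes x y m :: int
  assumes "[x * y = 1] (mod m)"
  shows "[ modular_inverse m x = y] (mod m)"
proof -
  have co: "coprime x m" using assms coprime_iff_invertible_int by blast
  have "[ modular_inverse m x * 1 = modular_inverse m x * (x * y)] (mod m)"
    by (intro cong_mult cong_refl cong_sym[OF assms])
  also have "modular_inverse m x * (x * y) = (modular_inverse m x * x) * y" by simp
  also have "[\<dots> = 1 * y] (mod m)"
    by (intro cong_mult cong_refl cong_modular_inverse2 co)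
  finally show ?thesis by simp
qed

lemma minv_power_cong:
  assumes "prime p" "0 < a" "a < p" "e \<le> p - 1"
  shows "[minv p a ^ e = int a ^ (p - 1 - e)] (mod int p)"
proof -
  have "[a ^ (p - 1) = 1] (mod p)"
    using fermat_theorem assms by (auto dest: nat_dvd_not_less)
  then have fermat: "[int a ^ (p - 1) = 1] (mod int p)"
    by (metis cong_int_iff of_nat_1 of_nat_power)
  have "[int a ^ (p - 1 - e) * 1 ^ e = int a ^ (p - 1 - e) * (int a * minv p a) ^ e] (mod int p)"
    using assms by (intro cong_mult cong_pow cong_refl cong_sym[OF times_minv_cong]) auto
  also have "int a ^ (p - 1 - e) * (int a * minv p a) ^ e = int a ^ (p - 1) * minv p a ^ e"
    using assms by (simp add: power_mult_distrib flip: power_add mult.assoc)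
  also have "[\<dots> = 1 * minv p a ^ e] (mod int p)"
    by (intro cong_mult cong_refl fermat)
  finally show ?thesis by (simp add: cong_sym_eq)
qed

lemma minv_reflect:
  assumes "prime p" "0 < m" "m < p"
  shows "[minv p (p - m) = - minv p m] (mod int p)"
proof (rule modular_inverse_cong_unique)
  have "[int (p - m) * - minv p m = - int m * - minv p m] (mod int p)"
    using assms by (intro cong_mult cong_refl) (simp add: cong_iff_dvd_diff of_nat_diff)
  also have "- int m * - minv p m = int m * minv p m" by simp
  also have "[\<dots> = 1] (mod int p)" using assms by (rule times_minv_cong)
  finally show "[int (p - m) * - minv p m = 1] (mod int p)" .
qed

lemma mod_term_cong:
  assumes "prime p" "ns \<in> dec_tuples p (length s)"
  shows "[ mod_term p s ns = (\<Prod>i<length s. 2 * minv p (ns ! i) ^ (s ! i))] (mod int p)"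
proof -
  have "[ modular_inverse (int p) (\<Prod>i<length s. int (ns ! i) ^ (s ! i)) =
         (\<Prod>i<length s. minv p (ns ! i) ^ (s ! i))] (mod int p)"
  proof (rule modular_inverse_cong_unique)
    have "[int (ns ! i) ^ (s ! i) * minv p (ns ! i) ^ (s ! i) = 1] (mod int p)"
      if "i < length s" for i
    proof -
      have "ns ! i \<in> set ns" using that assms(2) by (auto simp: dec_tuples_def)
      then have "[int (ns ! i) * minv p (ns ! i) = 1] (mod int p)"
        using assms by (intro times_minv_cong) (auto simp: dec_tuples_def)
      then show ?thesis by (metis cong_pow power_mult_distrib power_one)
    qed
    then have "[(\<Prod>i<length s. int (ns ! i) ^ (s ! i) * minv p (ns ! i) ^ (s ! i)) =
                (\<Prod>i<length s. 1)] (mod int p)"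
      by (intro cong_prod) auto
    then show "[(\<Prod>i<length s. int (ns ! i) ^ (s ! i)) * (\<Prod>i<length s. minv p (ns ! i) ^ (s ! i)) = 1]
      (mod int p)" by (simp add: prod.distrib)
  qed
  then have "[ mod_term p s ns = 2 ^ length s * (\<Prod>i<length s. minv p (ns ! i) ^ (s ! i))] (mod int p)"
    unfolding mod_term_def by (intro cong_mult cong_refl)
  then show ?thesis by (simp add: prod.distrib)
qed

section \<open>Sums over tuples of alternating parity\<close>

text \<open>
  Written as the parity of \<open>ns ! i + i + d\<close>, the conditions are easy to follow both when the
  largest entry is removed, which shifts \<open>i\<close> and \<open>d\<close>, and when the tuple is reflected.
\<close>

lemma T_tuples_iff: "ns \<in> T_tuples p d \<longleftrightarrow> ns \<in> dec_tuples p d \<and> (\<forall>i<d. even (ns ! i + i + d))"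
proof -
  have "[x = d - i] (mod 2) \<longleftrightarrow> even (x + i + d)" if "i < d" for x i
    using that by (simp add: cong_def mod2_eq_if)
  then show ?thesis by (auto simp: T_tuples_def)
qed

lemma S_tuples_iff: "ns \<in> S_tuples p d \<longleftrightarrow> ns \<in> dec_tuples p d \<and> (\<forall>i<d. odd (ns ! i + i + d))"
proof -
  have "[x = d - Suc i] (mod 2) \<longleftrightarrow> odd (x + i + d)" if "i < d" for x i
    using that by (simp add: cong_def mod2_eq_if)
  then show ?thesis by (auto simp: S_tuples_def)
qed

lemma finite_T_tuples: "finite (T_tuples p d)"
  by (rule finite_subset[OF _ finite_dec_tuples]) (auto simp: T_tuples_def)

lemma Cons_in_T_tuples_iff:
  "m # ns \<in> T_tuples q (Suc d) \<longleftrightarrow> 0 < m \<and> m < q \<and> odd (m + d) \<and> ns \<in> T_tuples m d"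
  by (auto simp: T_tuples_iff dec_tuples_def All_less_Suc2)

lemma sum_T_tuples_Suc:
  "(\<Sum>ns\<in>T_tuples q (Suc d). F ns) =
     (\<Sum>m | 0 < m \<and> m < q \<and> odd (m + d). \<Sum>ns\<in>T_tuples m d. F (m # ns))"
proof -
  have "(\<Sum>ns\<in>T_tuples q (Suc d). F ns) =
        (\<Sum>(m, ns)\<in>Sigma {m. 0 < m \<and> m < q \<and> odd (m + d)} (\<lambda>m. T_tuples m d). F (m # ns))"
  proof (rule sum.reindex_bij_witness[of _ "\<lambda>(m, ns). m # ns" "\<lambda>ns. (hd ns, tl ns)"])
    fix ns assume ns: "ns \<in> T_tuples q (Suc d)"
    then obtain m ms where "ns = m # ms"
      by (cases ns) (auto simp: T_tuples_def dec_tuples_def)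
    with ns show "(hd ns, tl ns) \<in> Sigma {m. 0 < m \<and> m < q \<and> odd (m + d)} (\<lambda>m. T_tuples m d)"
      "(case (hd ns, tl ns) of (m, ns) \<Rightarrow> m # ns) = ns"
      "(case (hd ns, tl ns) of (m, ns) \<Rightarrow> F (m # ns)) = F ns"
      by (auto simp: Cons_in_T_tuples_iff)
  qed (auto simp: Cons_in_T_tuples_iff)
  also have "\<dots> = (\<Sum>m | 0 < m \<and> m < q \<and> odd (m + d). \<Sum>ns\<in>T_tuples m d. F (m # ns))"
    by (rule sum.Sigma[symmetric]) (auto simp: finite_T_tuples)
  finally show ?thesis .
qed

text \<open>
  The sum of \<open>2^d / (n\<^sub>1 \<cdots> n\<^sub>d)\<close> modulo \<open>p\<close> over the alternating-parity tuples with largest entry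
  \<open>n\<^sub>1 = m\<close>. A virtual last entry \<open>0\<close> is appended to each tuple: this is the base case, and the requirement that
  consecutive entries differ in parity then forces \<open>n\<^sub>d\<close> to be odd.
\<close>

primrec head_sum :: "nat \<Rightarrow> nat \<Rightarrow> nat \<Rightarrow> int" where
  "head_sum p 0 m = (if m = 0 then 1 else 0)"
| "head_sum p (Suc d) m = 2 * minv p m * (\<Sum>l | l < m \<and> odd (l + m). head_sum p d l)"

lemma head_sum_eq_0: "odd (d + m) \<or> m < d \<Longrightarrow> head_sum p d m = 0"
proof (induction d arbitrary: m)
  case (Suc d)
  have "head_sum p d l = 0" if "l < m" "odd (l + m)" for l
    using Suc that by (intro Suc.IH) auto
  then show ?case by simp
qed (auto simp: odd_pos)

text \<open>
  For \<open>d > 0\<close> this classifies the tuples by their largest entry; for \<open>d = 0\<close> the virtual entry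
  \<open>m = 0\<close> accounts for the empty tuple, which is why \<open>q\<close> has to be positive.
\<close>

lemma sum_T_tuples_eq_head_sum:
  assumes "q > 0"
  shows "(\<Sum>ns\<in>T_tuples q d. \<Prod>i<d. 2 * minv p (ns ! i)) =
         (\<Sum>m | m < q \<and> even (m + d). head_sum p d m)"
  using assms
proof (induction d arbitrary: q)
  case 0
  have "T_tuples q 0 = {[]}" by (auto simp: T_tuples_def dec_tuples_def)
  moreover have "(\<Sum>m | m < q \<and> even m. if m = 0 then 1 else 0) = (1::int)"
    using 0 by (subst sum.delta) auto
  ultimately show ?case by simp
next
  case (Suc d)
  have "(\<Sum>ns\<in>T_tuples q (Suc d). \<Prod>i<Suc d. 2 * minv p (ns ! i)) =
        (\<Sum>m | 0 < m \<and> m < q \<and> odd (m + d).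
           2 * minv p m * (\<Sum>ns\<in>T_tuples m d. \<Prod>i<d. 2 * minv p (ns ! i)))"
    unfolding sum_T_tuples_Suc by (simp add: prod.lessThan_Suc_shift sum_distrib_left del: prod.lessThan_Suc)
  also have "\<dots> = (\<Sum>m | 0 < m \<and> m < q \<and> odd (m + d). head_sum p (Suc d) m)"
  proof (intro sum.cong refl)
    fix m assume m: "m \<in> {m. 0 < m \<and> m < q \<and> odd (m + d)}"
    then have "{l. l < m \<and> even (l + d)} = {l. l < m \<and> odd (l + m)}" by auto
    then show "2 * minv p m * (\<Sum>ns\<in>T_tuples m d. \<Prod>i<d. 2 * minv p (ns ! i)) = head_sum p (Suc d) m"
      using m by (simp only: Suc.IH mem_Collect_eq head_sum.simps)
  qed
  also have "\<dots> = (\<Sum>m | m < q \<and> even (m + Suc d). head_sum p (Suc d) m)"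
    by (rule sum.mono_neutral_left) (auto intro!: gr0I)
  finally show ?case .
qed

section \<open>Duality modulo a prime\<close>

text \<open>
  Both sides satisfy \<open>m g\<^sub>m = 2 a (\<Sum>l. g\<^sub>l)\<close>, summed over the \<open>l < m\<close> of the opposite parity, and
  \<open>m\<close> is invertible modulo \<open>p\<close>. The upper bound \<open>N\<close> is arbitrary because the summands with
  \<open>d > m\<close> vanish; the induction lowers it by one at each step.
\<close>

lemma head_sum_generating_function:
  assumes "prime p" "m < p" "m \<le> N"
  shows "[(\<Sum>d\<le>N. head_sum p d m * int a ^ d) = int (mittag_leffler m a)] (mod int p)"
  using assms(2,3)
proof (induction m arbitrary: N rule: less_induct)
  case (less m)
  show ?case
  proof (cases "m = 0")
    case True
    have "head_sum p d 0 * int a ^ d = (if d = 0 then 1 else 0)" for d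
      by (cases d) auto
    then show ?thesis using True by (simp add: sum.delta)
  next
    case False
    then obtain N' where N: "N = Suc N'" using less.prems by (cases N) auto
    let ?L = "{l. l < m \<and> odd (l + m)}"
    define S where "S d = (\<Sum>l\<in>?L. head_sum p d l)" for d
    have "int m * (\<Sum>d\<le>N. head_sum p d m * int a ^ d) =
          (\<Sum>d\<le>N'. (int m * minv p m) * (2 * int a * (S d * int a ^ d)))"
      unfolding N sum.atMost_Suc_shift S_def using False by (simp add: sum_distrib_left mult_ac)
    also have "[\<dots> = (\<Sum>d\<le>N'. 1 * (2 * int a * (S d * int a ^ d)))] (mod int p)"
      using assms(1) less.prems False
      by (intro cong_sum cong_mult cong_refl times_minv_cong) auto
    also have "(\<Sum>d\<le>N'. 1 * (2 * int a * (S d * int a ^ d))) = 2 * int a * (\<Sum>d\<le>N'. S d * int a ^ d)"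
      by (simp add: sum_distrib_left)
    also have "(\<Sum>d\<le>N'. S d * int a ^ d) = (\<Sum>l\<in>?L. \<Sum>d\<le>N'. head_sum p d l * int a ^ d)"
      unfolding S_def sum_distrib_right by (rule sum.swap)
    also have "[2 * int a * \<dots> = 2 * int a * (\<Sum>l\<in>?L. int (mittag_leffler l a))] (mod int p)"
      using less.prems N by (intro cong_mult cong_refl cong_sum less.IH) auto
    also have "2 * int a * (\<Sum>l\<in>?L. int (mittag_leffler l a)) = int m * int (mittag_leffler m a)"
      using arg_cong[OF times_mittag_leffler_eq_sum[of m a], of int] by simp
    finally show ?thesis
      using coprime_prime_residue[OF assms(1), of m] False less.prems by (simp add: cong_mult_lcancel)
  qed
qed

text \<open>
  Extraction of a coefficient of \<open>g\<^sub>m\<close> from its values: by \<open>sum_power_mod_prime\<close>, weighting with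
  \<open>a^(-e)\<close> kills every power \<open>a^d\<close> with \<open>d \<noteq> e\<close>. The exponents are only determined modulo
  \<open>p - 1\<close>, so \<open>d = 0\<close> and \<open>d = p - 1\<close> have to be kept apart from \<open>e\<close>: the bounds on \<open>e\<close> ensure
  this.
\<close>

lemma head_sum_eq_power_sum:
  assumes "prime p" "0 < m" "m < p" "0 < e" "e < p - 1"
  shows "[(\<Sum>a\<in>{0<..<p}. minv p a ^ e * int (mittag_leffler m a)) = - head_sum p e m] (mod int p)"
proof -
  have "[(\<Sum>a\<in>{0<..<p}. minv p a ^ e * int (mittag_leffler m a)) =
         (\<Sum>a\<in>{0<..<p}. int a ^ (p - 1 - e) * (\<Sum>d\<le>p - 1. head_sum p d m * int a ^ d))] (mod int p)"
    using assms by (intro cong_sum cong_mult minv_power_cong cong_sym[OF head_sum_generating_function]) auto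
  also have "(\<Sum>a\<in>{0<..<p}. int a ^ (p - 1 - e) * (\<Sum>d\<le>p - 1. head_sum p d m * int a ^ d)) =
             (\<Sum>a\<in>{0<..<p}. \<Sum>d\<le>p - 1. head_sum p d m * int a ^ (d + (p - 1 - e)))"
    by (simp add: sum_distrib_left power_add mult_ac)
  also have "\<dots> = (\<Sum>d\<le>p - 1. head_sum p d m * (\<Sum>a\<in>{0<..<p}. int a ^ (d + (p - 1 - e))))"
    by (subst sum.swap) (simp add: sum_distrib_left)
  also have "[\<dots> = (\<Sum>d\<le>p - 1. head_sum p d m * (if p - 1 dvd d + (p - 1 - e) then - 1 else 0))] (mod int p)"
    by (intro cong_sum cong_mult cong_refl sum_power_mod_prime assms)
  also have "(\<Sum>d\<le>p - 1. head_sum p d m * (if p - 1 dvd d + (p - 1 - e) then - 1 else 0)) =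
             (\<Sum>d\<le>p - 1. if d = e then - head_sum p d m else 0)"
  proof (intro sum.cong refl)
    fix d assume d: "d \<in> {..p - 1}"
    show "head_sum p d m * (if p - 1 dvd d + (p - 1 - e) then - 1 else 0) =
          (if d = e then - head_sum p d m else 0)"
    proof (cases "d = 0 \<or> d = e")
      case True
      (* For d = 0 the coefficient vanishes because m > 0. *)
      then show ?thesis using assms by auto
    next
      case False
      have "\<not> p - 1 dvd d + (p - 1 - e)"
      proof
        assume "p - 1 dvd d + (p - 1 - e)"
        then obtain c where c: "d + (p - 1 - e) = (p - 1) * c" by blast
        have "(p - 1) * c < (p - 1) * 2"
          using d assms(4,5) unfolding c[symmetric] atMost_iff by arith
        then have "c < 2" by (simp only: mult_less_cancel1)
        moreover have "c \<noteq> 0" using c False by (metis add_is_0 mult_0_right)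
        ultimately have "d + (p - 1 - e) = p - 1" using c by (simp add: less_2_cases_iff)
        then show False using False assms(4,5) by arith
      qed
      then show ?thesis using False by simp
    qed
  qed
  also have "\<dots> = - head_sum p e m" using assms by (simp add: sum.delta)
  finally show ?thesis .
qed

lemma T_sum_eq_head_sum:
  assumes "prime p"
  shows "[(\<Sum>ns\<in>T_tuples p (Suc k). mod_term p (Suc n # replicate k 1) ns) =
          (\<Sum>m\<in>{0<..<p}. minv p m ^ n * head_sum p (Suc k) m)] (mod int p)"
proof -
  let ?s = "Suc n # replicate k 1"
  let ?M = "{m. 0 < m \<and> m < p \<and> odd (m + k)}"
  have "[(\<Sum>ns\<in>T_tuples p (Suc k). mod_term p ?s ns) =
         (\<Sum>ns\<in>T_tuples p (Suc k). \<Prod>i<Suc k. 2 * minv p (ns ! i) ^ (?s ! i))] (mod int p)"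
    using mod_term_cong[OF assms, of _ ?s] by (intro cong_sum) (auto simp: T_tuples_def)
  also have "(\<Sum>ns\<in>T_tuples p (Suc k). \<Prod>i<Suc k. 2 * minv p (ns ! i) ^ (?s ! i)) =
        (\<Sum>m\<in>?M. 2 * minv p m ^ Suc n * (\<Sum>ns\<in>T_tuples m k. \<Prod>i<k. 2 * minv p (ns ! i)))"
    unfolding sum_T_tuples_Suc by (simp add: prod.lessThan_Suc_shift sum_distrib_left del: prod.lessThan_Suc)
  also have "\<dots> = (\<Sum>m\<in>?M. minv p m ^ n * head_sum p (Suc k) m)"
  proof (intro sum.cong refl)
    fix m assume m: "m \<in> ?M"
    then have "{l. l < m \<and> even (l + k)} = {l. l < m \<and> odd (l + m)}" by auto
    then have "(\<Sum>ns\<in>T_tuples m k. \<Prod>i<k. 2 * minv p (ns ! i)) =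
               (\<Sum>l | l < m \<and> odd (l + m). head_sum p k l)"
      using m by (simp only: sum_T_tuples_eq_head_sum mem_Collect_eq)
    then show "2 * minv p m ^ Suc n * (\<Sum>ns\<in>T_tuples m k. \<Prod>i<k. 2 * minv p (ns ! i)) =
               minv p m ^ n * head_sum p (Suc k) m"
      by (simp only: head_sum.simps power_Suc2 mult_ac)
  qed
  also have "\<dots> = (\<Sum>m\<in>{0<..<p}. minv p m ^ n * head_sum p (Suc k) m)"
  proof (rule sum.mono_neutral_left)
    have zero: "head_sum p (Suc k) m = 0" if "m \<in> {0<..<p} - ?M" for m
      using that by (intro head_sum_eq_0) auto
    show "\<forall>m\<in>{0<..<p} - ?M. minv p m ^ n * head_sum p (Suc k) m = 0"
      by (intro ballI) (simp only: zero mult_zero_right)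
  qed auto
  finally show ?thesis .
qed

text \<open>
  Writing \<open>m^(1 - n)\<close> as \<open>m^(-n) m\<close> brings in the symmetric quantity \<open>m g\<^sub>m(a)\<close>; apart from
  it, the summand depends on \<open>(m, n)\<close> exactly as it does on \<open>(a, e)\<close>.
\<close>

lemma T_sum_eq_double_sum:
  assumes "prime p" "0 < n" "0 < e" "e < p - 1"
  shows "[(\<Sum>ns\<in>T_tuples p e. mod_term p (n # replicate (e - 1) 1) ns) =
          - (\<Sum>m\<in>{0<..<p}. \<Sum>a\<in>{0<..<p}. minv p m ^ n * minv p a ^ e * int (m * mittag_leffler m a))] (mod int p)"
proof -
  obtain l k where l: "n = Suc l" and k: "e = Suc k" using assms(2,3) by (metis Suc_pred)
  have "[(\<Sum>ns\<in>T_tuples p e. mod_term p (n # replicate (e - 1) 1) ns) =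
         (\<Sum>m\<in>{0<..<p}. minv p m ^ l * head_sum p e m)] (mod int p)"
    unfolding l k diff_Suc_1 by (rule T_sum_eq_head_sum[OF assms(1)])
  also have "(\<Sum>m\<in>{0<..<p}. minv p m ^ l * head_sum p e m) =
             - (\<Sum>m\<in>{0<..<p}. 1 * (minv p m ^ l * (- head_sum p e m)))"
    by (simp add: sum_negf)
  also have "[\<dots> = - (\<Sum>m\<in>{0<..<p}. (int m * minv p m) * (minv p m ^ l *
      (\<Sum>a\<in>{0<..<p}. minv p a ^ e * int (mittag_leffler m a))))] (mod int p)"
    using assms by (intro cong_minus_minus_iff[THEN iffD2] cong_sum cong_mult cong_refl
        cong_sym[OF head_sum_eq_power_sum] cong_sym[OF times_minv_cong]) auto
  also have "(\<Sum>m\<in>{0<..<p}. (int m * minv p m) * (minv p m ^ l *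
      (\<Sum>a\<in>{0<..<p}. minv p a ^ e * int (mittag_leffler m a)))) =
      (\<Sum>m\<in>{0<..<p}. \<Sum>a\<in>{0<..<p}. minv p m ^ n * minv p a ^ e * int (m * mittag_leffler m a))"
    by (simp add: l sum_distrib_left mult_ac)
  finally show ?thesis .
qed

lemma T_sum_duality:
  assumes "prime p" "0 < n" "n < p - 1" "0 < e" "e < p - 1"
  shows "[(\<Sum>ns\<in>T_tuples p e. mod_term p (n # replicate (e - 1) 1) ns) =
          (\<Sum>ns\<in>T_tuples p n. mod_term p (e # replicate (n - 1) 1) ns)] (mod int p)"
proof -
  let ?D = "\<lambda>n e. \<Sum>m\<in>{0<..<p}. \<Sum>a\<in>{0<..<p}. minv p m ^ n * minv p a ^ e * int (m * mittag_leffler m a)"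
  have "[(\<Sum>ns\<in>T_tuples p e. mod_term p (n # replicate (e - 1) 1) ns) = - ?D n e] (mod int p)"
    by (rule T_sum_eq_double_sum[OF assms(1,2,4,5)])
  also have "?D n e = ?D e n"
    by (subst sum.swap) (simp only: times_mittag_leffler_commute mult_ac)
  also have "[- ?D e n = (\<Sum>ns\<in>T_tuples p n. mod_term p (e # replicate (n - 1) 1) ns)] (mod int p)"
    by (rule cong_sym[OF T_sum_eq_double_sum[OF assms(1,4,2,3)]])
  finally show ?thesis .
qed

section \<open>Reflection of tuples\<close>

definition reflect_tuple :: "nat \<Rightarrow> nat list \<Rightarrow> nat list" where
  "reflect_tuple p ns = rev (map (\<lambda>x. p - x) ns)"

lemma nth_reflect_tuple:
  "i < length ns \<Longrightarrow> reflect_tuple p ns ! i = p - ns ! (length ns - Suc i)"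
  by (simp add: reflect_tuple_def rev_nth)

lemma reflect_tuple_in_dec_tuples:
  assumes "ns \<in> dec_tuples p d"
  shows "reflect_tuple p ns \<in> dec_tuples p d"
  using assms unfolding dec_tuples_def reflect_tuple_def
  by (auto simp: sorted_wrt_rev sorted_wrt_map diff_less_mono2 intro: sorted_wrt_mono_rel[rotated])

lemma reflect_tuple_involution: "ns \<in> dec_tuples p d \<Longrightarrow> reflect_tuple p (reflect_tuple p ns) = ns"
  by (auto simp: reflect_tuple_def dec_tuples_def rev_map intro!: map_idI)

text \<open>
  The parity condition on the right differs from the one for \<open>T\<close> by the parity of \<open>d\<close>: it
  describes \<open>T\<close> in even depth and \<open>S\<close> in odd depth.
\<close>

lemma parity_reflect_tuple:
  assumes "odd p" "ns \<in> dec_tuples p d"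
  shows "(\<forall>i<d. even (reflect_tuple p ns ! i + i + d)) \<longleftrightarrow> (\<forall>i<d. even (ns ! i + i))"
proof -
  have len: "length ns = d" and bound: "\<And>i. i < d \<Longrightarrow> ns ! i < p"
    using assms(2) by (auto simp: dec_tuples_def)
  have flip: "even (reflect_tuple p ns ! i + i + d) \<longleftrightarrow> even (ns ! (d - Suc i) + (d - Suc i))" if "i < d" for i
    using that bound[of "d - Suc i"] \<open>odd p\<close> by (auto simp: nth_reflect_tuple len)
  have rev_all: "(\<forall>i<d. P (d - Suc i)) \<longleftrightarrow> (\<forall>i<d. P i)" for P
  proof (intro iffI allI impI)
    fix i assume "\<forall>i<d. P (d - Suc i)" "i < d"
    moreover from \<open>i < d\<close> have "d - Suc i < d" by simp
    ultimately have "P (d - Suc (d - Suc i))" by blast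
    then show "P i" using \<open>i < d\<close> by simp
  qed auto
  show ?thesis
    unfolding rev_all[of "\<lambda>i. even (ns ! i + i)", symmetric] using flip by blast
qed

lemma mod_term_reflect_tuple:
  assumes "prime p" "ns \<in> dec_tuples p (length s)"
  shows "[ mod_term p s (reflect_tuple p ns) = (- 1) ^ sum_list s * mod_term p (rev s) ns] (mod int p)"
proof -
  let ?d = "length s"
  have len: "length ns = ?d" using assms(2) by (simp add: dec_tuples_def)
  have "[ mod_term p s (reflect_tuple p ns) =
         (\<Prod>i<?d. 2 * minv p (reflect_tuple p ns ! i) ^ (s ! i))] (mod int p)"
    by (rule mod_term_cong[OF assms(1) reflect_tuple_in_dec_tuples[OF assms(2)]])
  also have "[(\<Prod>i<?d. 2 * minv p (reflect_tuple p ns ! i) ^ (s ! i)) =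
              (\<Prod>i<?d. 2 * (- minv p (ns ! (?d - Suc i))) ^ (s ! i))] (mod int p)"
  proof (intro cong_prod cong_mult cong_pow cong_refl)
    fix i assume "i \<in> {..<?d}"
    then have "ns ! (?d - Suc i) \<in> set ns" and nth: "reflect_tuple p ns ! i = p - ns ! (?d - Suc i)"
      using len by (auto simp: nth_reflect_tuple)
    then show "[minv p (reflect_tuple p ns ! i) = - minv p (ns ! (?d - Suc i))] (mod int p)"
      unfolding nth using assms by (intro minv_reflect) (auto simp: dec_tuples_def)
  qed
  also have "(\<Prod>i<?d. 2 * (- minv p (ns ! (?d - Suc i))) ^ (s ! i)) =
             (\<Prod>i<?d. (- 1) ^ (s ! i) * (2 * minv p (ns ! (?d - Suc i)) ^ (rev s ! (?d - Suc i))))"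
  proof (intro prod.cong refl)
    fix i assume "i \<in> {..<?d}"
    then have "rev s ! (?d - Suc i) = s ! i" by (simp add: rev_nth)
    then show "2 * (- minv p (ns ! (?d - Suc i))) ^ (s ! i) =
      (- 1) ^ (s ! i) * (2 * minv p (ns ! (?d - Suc i)) ^ (rev s ! (?d - Suc i)))"
      using power_minus[of "minv p (ns ! (?d - Suc i))"] by simp
  qed
  also have "\<dots> = (- 1) ^ sum_list s * (\<Prod>i<?d. 2 * minv p (ns ! i) ^ (rev s ! i))"
    unfolding prod.distrib[where g = "\<lambda>i. (- 1) ^ (s ! i)"]
      prod.nat_diff_reindex[of "\<lambda>i. 2 * minv p (ns ! i) ^ (rev s ! i)"]
    by (simp add: power_sum sum_list_sum_nth atLeast0LessThan)
  also have "[\<dots> = (- 1) ^ sum_list s * mod_term p (rev s) ns] (mod int p)"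
    using mod_term_cong[of p ns "rev s"] assms by (intro cong_mult cong_refl) (simp add: cong_sym)
  finally show ?thesis .
qed

lemma T_sum_reversal:
  assumes "prime p" "odd p" "length s = d"
  shows "[(\<Sum>ns\<in>T_tuples p d. mod_term p s ns) =
          (- 1) ^ sum_list s *
            (\<Sum>ns\<in>(if even d then T_tuples p d else S_tuples p d). mod_term p (rev s) ns)] (mod int p)"
proof -
  let ?R = "if even d then T_tuples p d else S_tuples p d"
  have R: "ns \<in> ?R \<longleftrightarrow> ns \<in> dec_tuples p d \<and> (\<forall>i<d. even (ns ! i + i))" for ns
    by (auto simp: T_tuples_iff S_tuples_iff)
  have to_T: "reflect_tuple p ns \<in> T_tuples p d" if "ns \<in> ?R" for ns
    using that parity_reflect_tuple[OF assms(2), of ns d] reflect_tuple_in_dec_tuples[of ns p d]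
    unfolding R T_tuples_iff by blast
  have to_R: "reflect_tuple p ns \<in> ?R" if "ns \<in> T_tuples p d" for ns
  proof -
    have ns: "ns \<in> dec_tuples p d" and "\<forall>i<d. even (ns ! i + i + d)"
      using that by (auto simp only: T_tuples_iff)
    then show ?thesis
      using parity_reflect_tuple[OF assms(2) reflect_tuple_in_dec_tuples[OF ns]]
        reflect_tuple_in_dec_tuples[OF ns]
      unfolding R reflect_tuple_involution[OF ns] by blast
  qed
  have "(\<Sum>ns\<in>T_tuples p d. mod_term p s ns) = (\<Sum>ns\<in>?R. mod_term p s (reflect_tuple p ns))"
  proof (rule sum.reindex_bij_witness[of _ "reflect_tuple p" "reflect_tuple p"])
    show "reflect_tuple p (reflect_tuple p ns) = ns" if "ns \<in> T_tuples p d" for ns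
      using that by (intro reflect_tuple_involution[of _ p d]) (simp add: T_tuples_iff)
    then show "mod_term p s (reflect_tuple p (reflect_tuple p ns)) = mod_term p s ns"
      if "ns \<in> T_tuples p d" for ns using that by simp
    show "reflect_tuple p (reflect_tuple p ns) = ns" if "ns \<in> ?R" for ns
      using that by (intro reflect_tuple_involution[of _ p d]) (simp only: R)
  qed (fact to_T to_R)+
  also have "[\<dots> = (\<Sum>ns\<in>?R. (- 1) ^ sum_list s * mod_term p (rev s) ns)] (mod int p)"
    using assms by (intro cong_sum mod_term_reflect_tuple) (auto simp: R simp del: if_split)
  finally show ?thesis by (simp only: sum_distrib_left)
qed

section \<open>Passage to the ring of residues modulo almost all primes\<close>

lemma A_class_uminus: "\<ominus>\<^bsub>A_ring\<^esub> A_class f = A_class (\<lambda>p. - f p)"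
proof -
  interpret P: cring prime_residues_prod by (rule prime_residues_prod_cring)
  interpret H: ring_hom_ring prime_residues_prod A_ring
      "(+>\<^bsub>prime_residues_prod\<^esub>) prime_residues_sum"
    unfolding A_ring_def by (rule ideal.rcos_ring_hom_ring[OF prime_residues_sum_ideal])
  define h where "h = (\<lambda>f :: nat \<Rightarrow> int. \<lambda>p\<in>{p. prime p}. f p mod int p)"
  have h: "h f \<in> carrier prime_residues_prod" for f
    unfolding h_def by (rule mod_in_prime_residues_prod)
  have "h (\<lambda>p. - f p) \<oplus>\<^bsub>prime_residues_prod\<^esub> h f = \<zero>\<^bsub>prime_residues_prod\<^esub>"
    by (auto simp: h_def prime_residues_prod_def residue_ring_def mod_add_eq fun_eq_iff)
  then have "h (\<lambda>p. - f p) = \<ominus>\<^bsub>prime_residues_prod\<^esub> h f"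
    using h P.minus_equality by metis
  moreover have "A_class f = prime_residues_sum +>\<^bsub>prime_residues_prod\<^esub> h f" for f
    by (simp add: A_class_def h_def)
  ultimately show ?thesis
    using h by (simp add: H.hom_a_inv)
qed

lemma minus_one_power_times_A_class:
  "(\<ominus>\<^bsub>A_ring\<^esub> \<one>\<^bsub>A_ring\<^esub>) [^]\<^bsub>A_ring\<^esub> (k::nat) \<otimes>\<^bsub>A_ring\<^esub> A_class f =
     A_class (\<lambda>p. (- 1) ^ k * f p)"
proof -
  interpret A: cring A_ring by (rule A_ring_cring)
  note [simp] = A_class_in_carrier
  show ?thesis
  proof (induction k)
    case (Suc k)
    have "(\<ominus>\<^bsub>A_ring\<^esub> \<one>\<^bsub>A_ring\<^esub>) [^]\<^bsub>A_ring\<^esub> Suc k \<otimes>\<^bsub>A_ring\<^esub> A_class f =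
          \<ominus>\<^bsub>A_ring\<^esub> ((\<ominus>\<^bsub>A_ring\<^esub> \<one>\<^bsub>A_ring\<^esub>) [^]\<^bsub>A_ring\<^esub> k \<otimes>\<^bsub>A_ring\<^esub> A_class f)"
      by (simp add: A.r_minus A.l_minus)
    then show ?case by (simp add: Suc A_class_uminus)
  qed simp
qed

lemma A_class_eqI:
  assumes "\<And>p. prime p \<Longrightarrow> N < p \<Longrightarrow> [f p = g p] (mod int p)"
  shows "A_class f = A_class g"
  unfolding A_class_eq_iff
  by (rule finite_subset[of _ "{..N}"]) (use assms in \<open>auto simp: not_less[symmetric]\<close>)

theorem T_A_duality:
  assumes "0 < n" "0 < e"
  shows "T_A (n # replicate (e - 1) 1) = T_A (e # replicate (n - 1) 1)"
  unfolding T_A_def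
proof (rule A_class_eqI[where N = "n + e + 1"])
  fix p assume "prime p" "n + e + 1 < p"
  then show "[(\<Sum>ns\<in>T_tuples p (length (n # replicate (e - 1) 1)). mod_term p (n # replicate (e - 1) 1) ns) =
     (\<Sum>ns\<in>T_tuples p (length (e # replicate (n - 1) 1)). mod_term p (e # replicate (n - 1) 1) ns)] (mod int p)"
    using T_sum_duality[of p n e] assms by simp
qed

lemma T_A_reversal:
  assumes "even (sum_list s + k)"
  shows "T_A s = (\<ominus>\<^bsub>A_ring\<^esub> \<one>\<^bsub>A_ring\<^esub>) [^]\<^bsub>A_ring\<^esub> k \<otimes>\<^bsub>A_ring\<^esub>
     (if even (length s) then T_A (rev s) else S_A (rev s))"
proof -
  let ?R = "\<lambda>p. if even (length s) then T_tuples p (length s) else S_tuples p (length s)"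
  have "T_A s = A_class (\<lambda>p. (- 1) ^ sum_list s * (\<Sum>ns\<in>?R p. mod_term p (rev s) ns))"
    unfolding T_A_def
  proof (rule A_class_eqI[where N = 2])
    fix p :: nat assume "prime p" "2 < p"
    then show "[(\<Sum>ns\<in>T_tuples p (length s). mod_term p s ns) =
        (- 1) ^ sum_list s * (\<Sum>ns\<in>?R p. mod_term p (rev s) ns)] (mod int p)"
      by (intro T_sum_reversal prime_odd_nat refl)
  qed
  also have "(- 1 :: int) ^ sum_list s = (- 1) ^ k"
    using assms by (auto simp: minus_one_power_iff)
  finally show ?thesis
    by (simp add: T_A_def S_A_def minus_one_power_times_A_class)
qed

theorem theorem4p6:
  fixes n k :: nat
  assumes "n > 0" and "k > 0"
  shows "T_A (n # replicate k 1) = T_A ((k + 1) # replicate (n - 1) 1) \<and>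
         T_A ((2 * n) # replicate k 1) =
           (\<ominus>\<^bsub>A_ring\<^esub> \<one>\<^bsub>A_ring\<^esub>) [^]\<^bsub>A_ring\<^esub> k \<otimes>\<^bsub>A_ring\<^esub>
             T_A (replicate (2 * n - 1) 1 @ [k + 1]) \<and>
         T_A ((2 * n + 1) # replicate k 1) =
           (\<ominus>\<^bsub>A_ring\<^esub> \<one>\<^bsub>A_ring\<^esub>) [^]\<^bsub>A_ring\<^esub> (k + 1) \<otimes>\<^bsub>A_ring\<^esub>
             S_A (replicate (2 * n) 1 @ [k + 1])"
proof (intro conjI)
  show "T_A (n # replicate k 1) = T_A ((k + 1) # replicate (n - 1) 1)"
    using T_A_duality[of n "k + 1"] assms by simp
  show "T_A ((2 * n) # replicate k 1) =
           (\<ominus>\<^bsub>A_ring\<^esub> \<one>\<^bsub>A_ring\<^esub>) [^]\<^bsub>A_ring\<^esub> k \<otimes>\<^bsub>A_ring\<^esub>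
             T_A (replicate (2 * n - 1) 1 @ [k + 1])"
  proof -
    let ?s = "(k + 1) # replicate (2 * n - 1) 1"
    have "T_A ((2 * n) # replicate k 1) = T_A ?s"
      using T_A_duality[of "2 * n" "k + 1"] assms by simp
    then show ?thesis
      using T_A_reversal[of ?s k] assms by (simp add: sum_list_replicate)
  qed
  show "T_A ((2 * n + 1) # replicate k 1) =
           (\<ominus>\<^bsub>A_ring\<^esub> \<one>\<^bsub>A_ring\<^esub>) [^]\<^bsub>A_ring\<^esub> (k + 1) \<otimes>\<^bsub>A_ring\<^esub>
             S_A (replicate (2 * n) 1 @ [k + 1])"
  proof -
    let ?s = "(k + 1) # replicate (2 * n) 1"
    have "T_A ((2 * n + 1) # replicate k 1) = T_A ?s"
      using T_A_duality[of "2 * n + 1" "k + 1"] by simp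
    then show ?thesis
      using T_A_reversal[of ?s "k + 1"] by (simp add: sum_list_replicate)
  qed
qed

end
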